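(* Each of the two optimization problems $$\text{minimize } \mathcal{G}(x)\ \text{ subject to } x\in S \qquad\text{and}\qquad \text{minimize } \mathcal{H}(x)\ \text{ subject to } x\in S$$ has a nonempty optimal solution set (i.e. the infimum over $S$ is attained at some point of $S$) under any one of the following assumptions: (i) The constraint set $S$ is compact. (ii) $I\neq\emptyset$ and $X$ is finite dimensional. (iii) $J\neq\emptyset$, at least one of the sets $\Theta_j$, $j\in J$, is compact, and $X$ is finite dimensional. (iv) $X$ is a reflexive Banach space; $S$ and $\Theta_j$ for all $j\in J$ are weakly closed; and at least one of these sets ($S$, $\Theta_j$ for $j\in J$) is bounded.
   Context: Standing setting: $X$ is a (real) normed space; $F\subset X$ is a closed, bounded, convex set containing $0$ as an interior point; $I$ and $J$ are finite index sets with $I\cup J\neq\emptyset$; $\Omega_i\subset X$ is nonempty, closed and bounded for every $i\in I$; $\Theta_j\subset X$ is nonempty and closed for every $j\in J$; $S\subset X$ is nonempty and closed. For a nonempty closed bounded set $Q\subset X$, $C_F(x;Q):=\inf\{t\ge 0: Q\subset x+tF\}$ (maximal time function). For a nonempty closed set $Q\subset X$, $T_F(x;Q):=\inf\{t\ge 0: (x+tF)\cap Q\neq\emptyset\}$ (minimal time function). $\mathcal{G}(x):=\max\{C_F(x;\Omega_i),\,T_F(x;\Theta_j): i\in I,\ j\in J\}$ and $\mathcal{H}(x):=\sum_{i\in I}C_F(x;\Omega_i)+\sum_{j\in J}T_F(x;\Theta_j)$. *)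

theory Defs
  imports "HOL-Analysis.Analysis"
begin

text \<open>
  \<open>dilate F x t\<close> is the set \<open>x + t F\<close>. The real-valued \<open>Inf\<close> in the two functions below is a
  genuine infimum for bounded (resp. nonempty) \<open>Q\<close> when 0 is interior to \<open>F\<close>: see
  \<open>max_time_feasible\<close> and \<open>min_time_feasible\<close>.
\<close>

definition dilate :: "'a::real_normed_vector set \<Rightarrow> 'a \<Rightarrow> real \<Rightarrow> 'a set" where
  "dilate F x t = (\<lambda>f. x + t *\<^sub>R f) ` F"

definition max_time :: "'a::real_normed_vector set \<Rightarrow> 'a \<Rightarrow> 'a set \<Rightarrow> real" where
  "max_time F x Q = Inf {t. 0 \<le> t \<and> Q \<subseteq> dilate F x t}"

definition min_time :: "'a::real_normed_vector set \<Rightarrow> 'a \<Rightarrow> 'a set \<Rightarrow> real" where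
  "min_time F x Q = Inf {t. 0 \<le> t \<and> dilate F x t \<inter> Q \<noteq> {}}"

lemma max_time_feasible:
  fixes F Q :: "'a::real_normed_vector set"
  assumes "0 \<in> interior F" "bounded Q"
  shows "{t. 0 \<le> t \<and> Q \<subseteq> dilate F x t} \<noteq> {}"
proof -
  obtain r where r: "r > 0" "ball 0 r \<subseteq> F"
    using assms(1) by (meson mem_interior)
  obtain B where B: "\<And>q. q \<in> Q \<Longrightarrow> dist x q \<le> B"
    using assms(2) by (meson bounded_any_center)
  define t where "t = (\<bar>B\<bar> + 1) / r"
  have t: "t > 0" using r by (simp add: t_def add_nonneg_pos)
  have "q \<in> dilate F x t" if "q \<in> Q" for q
  proof -
    have "norm (q - x) < t * r"
      using B[OF that] r by (simp add: t_def dist_norm norm_minus_commute)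
    hence "norm ((q - x) /\<^sub>R t) < r"
      using t by (simp add: divide_simps mult.commute)
    hence "(q - x) /\<^sub>R t \<in> F" using r by auto
    moreover have "q = x + t *\<^sub>R ((q - x) /\<^sub>R t)" using t by simp
    ultimately show ?thesis unfolding dilate_def by blast
  qed
  with t show ?thesis by (auto intro!: exI[of _ t])
qed

lemma min_time_feasible:
  fixes F Q :: "'a::real_normed_vector set"
  assumes "0 \<in> interior F" "Q \<noteq> {}"
  shows "{t. 0 \<le> t \<and> dilate F x t \<inter> Q \<noteq> {}} \<noteq> {}"
proof -
  obtain q where "q \<in> Q" using assms(2) by blast
  with max_time_feasible[OF assms(1), of "{q}" x] show ?thesis by auto
qed

text \<open>The maximum is over a nonempty finite set as soon as \<open>I\<close>, \<open>J\<close> are finite and not both empty.\<close>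

definition G_obj :: "'a::real_normed_vector set \<Rightarrow> 'i set \<Rightarrow> ('i \<Rightarrow> 'a set) \<Rightarrow>
    'j set \<Rightarrow> ('j \<Rightarrow> 'a set) \<Rightarrow> 'a \<Rightarrow> real" where
  "G_obj F I \<Omega> J \<Theta> x =
     Max ((\<lambda>i. max_time F x (\<Omega> i)) ` I \<union> (\<lambda>j. min_time F x (\<Theta> j)) ` J)"

definition H_obj :: "'a::real_normed_vector set \<Rightarrow> 'i set \<Rightarrow> ('i \<Rightarrow> 'a set) \<Rightarrow>
    'j set \<Rightarrow> ('j \<Rightarrow> 'a set) \<Rightarrow> 'a \<Rightarrow> real" where
  "H_obj F I \<Omega> J \<Theta> x =
     (\<Sum>i\<in>I. max_time F x (\<Omega> i)) + (\<Sum>j\<in>J. min_time F x (\<Theta> j))"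

definition optimal_solutions :: "('a \<Rightarrow> real) \<Rightarrow> 'a set \<Rightarrow> 'a set" where
  "optimal_solutions f S = {x \<in> S. \<forall>y\<in>S. f x \<le> f y}"

definition finite_dimensional :: "'a::real_vector itself \<Rightarrow> bool" where
  "finite_dimensional _ \<longleftrightarrow> (\<exists>B::'a set. finite B \<and> span B = UNIV)"

text \<open>Completeness together with surjectivity of the canonical embedding into the bidual.\<close>

definition reflexive_banach :: "'a::real_normed_vector itself \<Rightarrow> bool" where
  "reflexive_banach _ \<longleftrightarrow> complete (UNIV :: 'a set) \<and>
     (\<forall>\<phi> :: ('a \<Rightarrow>\<^sub>L real) \<Rightarrow>\<^sub>L real. \<exists>x::'a. \<forall>f. blinfun_apply \<phi> f = blinfun_apply f x)"

text \<open>The coarsest topology making all bounded linear functionals continuous.\<close>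

definition weak_topology :: "'a::real_normed_vector topology" where
  "weak_topology =
     topology_generated_by {blinfun_apply f -` U |(f :: 'a \<Rightarrow>\<^sub>L real) U. open U}"

lemma topspace_weak_topology [simp]: "topspace weak_topology = UNIV"
  unfolding weak_topology_def topology_generated_by_topspace
  by (auto intro!: exI[of _ "UNIV :: 'a set"] exI[of _ "UNIV :: real set"])

definition weakly_closed :: "'a::real_normed_vector set \<Rightarrow> bool" where
  "weakly_closed S \<longleftrightarrow> closedin weak_topology S"

end

theory Submission
  imports Defs
begin

text \<open>
  Both objectives attain their infimum by the direct method: each is lower semicontinuous for a
  topology in which a nonempty sublevel set on \<open>S\<close> lies in a compact set.

  The Minkowski functional \<open>\<rho>\<close> of \<open>F\<close> turns the time functions into statements about \<open>\<rho>\<close>: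
  \<open>C_F(x;Q) \<le> c\<close> says \<open>\<rho>(q - x) \<le> c\<close> for all \<open>q \<in> Q\<close>, and \<open>T_F(x;Q) \<le> c\<close> says that
  for every \<open>e > 0\<close> some \<open>q \<in> Q\<close> has \<open>\<rho>(q - x) \<le> c + e\<close>.
  Since \<open>F\<close> is bounded with \<open>0\<close> in its interior, \<open>\<rho>\<close> is sublinear and comparable with
  the norm in both directions. Hence \<open>C_F(\<cdot>;Q)\<close> and \<open>T_F(\<cdot>;Q)\<close> have
  bounded sublevel sets as soon as \<open>Q\<close> is bounded. Both objectives dominate each of their terms,
  so one bounded \<open>\<Omega>\<^sub>i\<close> or \<open>\<Theta>\<^sub>j\<close> bounds the sublevel sets of \<open>\<G>\<close> and \<open>\<H>\<close>.

  In a finite-dimensional space closed balls are norm compact, and the norm topology serves for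
  compact \<open>S\<close> as well. In a reflexive space closed balls are weakly compact
  (\<open>weakly_compact_cball\<close>), so lower semicontinuity is needed for the weak topology. There the
  Hahn-Banach theorem enters: a sublinear functional bounded by a multiple of the norm is the
  supremum of the continuous linear functionals below it, so its sublevel sets are weakly closed,
  and \<open>C_F(\<cdot>;Q)\<close> is weakly lower semicontinuous. For \<open>T_F(\<cdot>;\<Theta>)\<close> the sublevel sets are
  intersections of sets \<open>\<Theta> - K\<close> with \<open>K\<close> weakly compact, and these are weakly closed when
  \<open>\<Theta>\<close> is.
\<close>

section \<open>Sublinear functionals and the Hahn-Banach theorem\<close>

definition sublinear :: "('a::real_vector \<Rightarrow> real) \<Rightarrow> bool" where
  "sublinear p \<longleftrightarrow> (\<forall>x y. p (x + y) \<le> p x + p y) \<and> (\<forall>t x. 0 \<le> t \<longrightarrow> p (t *\<^sub>R x) = t * p x)"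

lemma sublinear_add: "sublinear p \<Longrightarrow> p (x + y) \<le> p x + p y"
  by (simp add: sublinear_def)

lemma sublinear_scaleR: "sublinear p \<Longrightarrow> 0 \<le> t \<Longrightarrow> p (t *\<^sub>R x) = t * p x"
  by (simp add: sublinear_def)

lemma sublinear_zero: "sublinear p \<Longrightarrow> p 0 = 0"
  using sublinear_scaleR[of p 0 0] by simp

lemma sublinear_minus_le: "sublinear p \<Longrightarrow> - p (- x) \<le> p x"
  using sublinear_add[of p x "- x"] sublinear_zero[of p] by simp

lemma sublinear_norm: "sublinear (norm :: 'a::real_normed_vector \<Rightarrow> real)"
  by (simp add: sublinear_def norm_triangle_ineq)

lemma sublinearI:
  assumes add: "\<And>x y. p (x + y) \<le> p x + p y" and zero: "p 0 = 0"
    and scale: "\<And>t x. 0 < t \<Longrightarrow> p (t *\<^sub>R x) \<le> t * p x"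
  shows "sublinear p"
proof -
  have "t * p x \<le> p (t *\<^sub>R x)" if "0 < t" for t x
    using scale[of "inverse t" "t *\<^sub>R x"] that by (simp add: field_simps)
  with scale have "p (t *\<^sub>R x) = t * p x" if "0 < t" for t x
    using that by (simp add: order_antisym)
  then show ?thesis
    using add zero by (auto simp: sublinear_def order_le_less)
qed

text \<open>
  This moves \<open>p\<close> down towards linearity in direction \<open>y\<close>: \<open>ray_inf p y\<close> is sublinear and lies
  below \<open>p\<close>, and taking \<open>t = 1\<close> at \<open>x = - y\<close> gives \<open>ray_inf p y (- y) \<le> - p y\<close>. A sublinear functional that
  no such step decreases, for any \<open>y\<close>, is therefore linear.
\<close>

definition ray_inf :: "('a::real_vector \<Rightarrow> real) \<Rightarrow> 'a \<Rightarrow> 'a \<Rightarrow> real" where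
  "ray_inf p y x = (INF t\<in>{0..}. p (x + t *\<^sub>R y) - t * p y)"

lemma ray_inf_le:
  assumes "sublinear p" "0 \<le> t"
  shows "ray_inf p y x \<le> p (x + t *\<^sub>R y) - t * p y"
  unfolding ray_inf_def
proof (rule cINF_lower)
  have "- p (- x) \<le> p (x + s *\<^sub>R y) - s * p y" if "0 \<le> s" for s
    using sublinear_add[OF assms(1), of "x + s *\<^sub>R y" "- x"] sublinear_scaleR[OF assms(1) that, of y]
    by simp
  then show "bdd_below ((\<lambda>t. p (x + t *\<^sub>R y) - t * p y) ` {0..})"
    by (intro bdd_belowI2[where m = "- p (- x)"]) simp
qed (use assms in simp)

lemma ray_inf_greatest:
  assumes "\<And>t. 0 \<le> t \<Longrightarrow> c \<le> p (x + t *\<^sub>R y) - t * p y"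
  shows "c \<le> ray_inf p y x"
  unfolding ray_inf_def using assms by (intro cINF_greatest) auto

lemma ray_inf_le_self: "sublinear p \<Longrightarrow> ray_inf p y x \<le> p x"
  using ray_inf_le[of p 0 y x] by simp

lemma sublinear_ray_inf:
  assumes p: "sublinear p"
  shows "sublinear (ray_inf p y)"
proof (rule sublinearI)
  fix u v
  have split: "ray_inf p y (u + v) - (p (u + t *\<^sub>R y) - t * p y) \<le> p (v + s *\<^sub>R y) - s * p y"
    if "0 \<le> t" "0 \<le> s" for t s
    using ray_inf_le[OF p, of "t + s" y "u + v"] that
      sublinear_add[OF p, of "u + t *\<^sub>R y" "v + s *\<^sub>R y"]
    by (simp add: algebra_simps)
  have "ray_inf p y (u + v) - (p (u + t *\<^sub>R y) - t * p y) \<le> ray_inf p y v" if "0 \<le> t" for t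
    using that by (intro ray_inf_greatest split)
  then have "ray_inf p y (u + v) - ray_inf p y v \<le> p (u + t *\<^sub>R y) - t * p y" if "0 \<le> t" for t
    using that by (simp add: algebra_simps)
  then have "ray_inf p y (u + v) - ray_inf p y v \<le> ray_inf p y u"
    by (rule ray_inf_greatest)
  then show "ray_inf p y (u + v) \<le> ray_inf p y u + ray_inf p y v" by simp
next
  show "ray_inf p y 0 = 0"
    by (rule antisym[OF _ ray_inf_greatest])
       (use ray_inf_le_self[OF p, of y 0] in \<open>simp_all add: sublinear_zero[OF p] sublinear_scaleR[OF p]\<close>)
next
  fix t :: real and x assume t: "0 < t"
  have "ray_inf p y (t *\<^sub>R x) / t \<le> ray_inf p y x"
  proof (rule ray_inf_greatest)
    fix s :: real assume s: "0 \<le> s"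
    have "ray_inf p y (t *\<^sub>R x) \<le> t * (p (x + s *\<^sub>R y) - s * p y)"
      using ray_inf_le[OF p, of "t * s" y "t *\<^sub>R x"] t s
        sublinear_scaleR[OF p, of t "x + s *\<^sub>R y"]
      by (simp add: algebra_simps)
    then show "ray_inf p y (t *\<^sub>R x) / t \<le> p (x + s *\<^sub>R y) - s * p y"
      using t by (simp add: field_simps)
  qed
  then show "ray_inf p y (t *\<^sub>R x) \<le> t * ray_inf p y x"
    using t by (simp add: field_simps)
qed

text \<open>
  Zorn's lemma for the pointwise order. The pointwise infimum of a chain is finite because every
  sublinear \<open>f \<le> p\<close> satisfies \<open>- p (- x) \<le> f x\<close>, and it is subadditive because two members of a
  chain have a smaller one.
\<close>

lemma minimal_sublinear_exists:
  assumes p: "sublinear p"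
  obtains f where "sublinear f" "f \<le> p" "\<And>q. sublinear q \<Longrightarrow> q \<le> f \<Longrightarrow> q = f"
proof -
  let ?A = "{q. sublinear q \<and> q \<le> p}"
  have "\<exists>m\<in>?A. \<forall>q\<in>?A. q \<le> m \<longrightarrow> q = m"
  proof (rule predicate_Zorn)
    show "partial_order_on ?A (relation_of (\<lambda>f g. g \<le> f) ?A)"
      by (auto simp: partial_order_on_def preorder_on_def refl_on_def trans_def antisym_def
          relation_of_def)
  next
    fix C assume "C \<in> Chains (relation_of (\<lambda>f g. g \<le> f) ?A)"
    then have chain: "\<And>f g. f \<in> C \<Longrightarrow> g \<in> C \<Longrightarrow> f \<le> g \<or> g \<le> f"
      and C: "\<And>f. f \<in> C \<Longrightarrow> sublinear f \<and> f \<le> p"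
      unfolding Chains_def relation_of_def by auto
    show "\<exists>u\<in>?A. \<forall>a\<in>C. u \<le> a"
    proof (cases "C = {}")
      case True
      then show ?thesis using p by auto
    next
      case False
      define h where "h x = (INF f\<in>C. f x)" for x
      have below: "- p (- x) \<le> f x" if "f \<in> C" for f x
        using sublinear_minus_le[of f x] C[OF that] le_funD[of f p "- x"] by fastforce
      have h_le: "h x \<le> f x" if "f \<in> C" for f x
        unfolding h_def using that below by (intro cINF_lower bdd_belowI2)
      have h_greatest: "c \<le> h x" if "\<And>f. f \<in> C \<Longrightarrow> c \<le> f x" for c x
        unfolding h_def using that False by (intro cINF_greatest) auto
      have "sublinear h"
      proof (rule sublinearI)
        fix x y
        have "h (x + y) \<le> f x + g y" if "f \<in> C" "g \<in> C" for f g
        proof -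
          obtain k where k: "k \<in> C" "k \<le> f" "k \<le> g"
            using chain[OF \<open>f \<in> C\<close> \<open>g \<in> C\<close>] \<open>f \<in> C\<close> \<open>g \<in> C\<close> by blast
          have "h (x + y) \<le> k x + k y"
            using h_le[OF k(1)] sublinear_add[of k x y] C[OF k(1)] order_trans by blast
          also have "\<dots> \<le> f x + g y"
            using k by (intro add_mono) (auto simp: le_fun_def)
          finally show ?thesis .
        qed
        then have "h (x + y) - f x \<le> g y" if "f \<in> C" "g \<in> C" for f g
          using that by (simp add: algebra_simps)
        then have "h (x + y) - f x \<le> h y" if "f \<in> C" for f
          using that by (intro h_greatest)
        then have "h (x + y) - h y \<le> f x" if "f \<in> C" for f
          using that by (simp add: algebra_simps)
        then have "h (x + y) - h y \<le> h x"
          by (rule h_greatest)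
        then show "h (x + y) \<le> h x + h y" by simp
      next
        obtain f where "f \<in> C" using False by auto
        then show "h 0 = 0"
          using h_le[of f 0] C sublinear_zero by (intro antisym h_greatest) fastforce+
      next
        fix t :: real and x assume t: "0 < t"
        have "h (t *\<^sub>R x) / t \<le> h x"
        proof (rule h_greatest)
          fix f assume f: "f \<in> C"
          then show "h (t *\<^sub>R x) / t \<le> f x"
            using h_le[OF f, of "t *\<^sub>R x"] sublinear_scaleR[of f t x] C t by (simp add: field_simps)
        qed
        then show "h (t *\<^sub>R x) \<le> t * h x" using t by (simp add: field_simps)
      qed
      moreover obtain f where "f \<in> C" using False by auto
      then have "h \<le> p" using h_le[of f] C[of f] by (meson le_fun_def order_trans)
      ultimately show ?thesis using h_le by (auto simp: le_fun_def intro!: bexI[of _ h])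
    qed
  qed
  then show ?thesis using that order_trans by blast
qed

lemma linear_if_minimal_sublinear:
  assumes f: "sublinear f" and min: "\<And>q. sublinear q \<Longrightarrow> q \<le> f \<Longrightarrow> q = f"
  shows "linear f"
proof -
  have ray: "ray_inf f y = f" for y
    using ray_inf_le_self[OF f] by (intro min sublinear_ray_inf[OF f]) (simp add: le_fun_def)
  have add: "f (x + y) = f x + f y" for x y
    using ray_inf_le[OF f, of 1 y x] sublinear_add[OF f, of x y] by (simp add: ray)
  have minus: "f (- x) = - f x" for x
    using add[of x "- x"] sublinear_zero[OF f] by simp
  have "f (t *\<^sub>R x) = t * f x" for t x
  proof (cases "0 \<le> t")
    case False
    then show ?thesis
      using sublinear_scaleR[OF f, of "- t" x] minus[of "t *\<^sub>R x"] by simp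
  qed (simp add: sublinear_scaleR[OF f])
  with add show ?thesis by (intro linearI) simp_all
qed

text \<open>
  A minimal sublinear functional below \<open>p\<close> is linear. Starting below \<open>ray_inf p v\<close> instead of
  \<open>p\<close> forces \<open>f (- v) \<le> - p v\<close>, that is, \<open>f v \<ge> p v\<close>.
\<close>

theorem Hahn_Banach_dominated:
  assumes p: "sublinear p"
  obtains f where "linear f" "\<And>x. f x \<le> p x" "f v = p v"
proof -
  obtain f where f: "sublinear f" "f \<le> ray_inf p v" "\<And>q. sublinear q \<Longrightarrow> q \<le> f \<Longrightarrow> q = f"
    using minimal_sublinear_exists[OF sublinear_ray_inf[OF p, of v]] by blast
  have lin: "linear f" using linear_if_minimal_sublinear[OF f(1,3)] by blast
  have le: "f x \<le> p x" for x
    using f(2) ray_inf_le_self[OF p, of v x] order_trans by (auto simp: le_fun_def)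
  have "f (- v) \<le> - p v"
    using f(2) ray_inf_le[OF p, of 1 v "- v"] sublinear_zero[OF p] order_trans
    by (auto simp: le_fun_def)
  then have "f v = p v" using le[of v] linear_neg[OF lin, of v] by simp
  with lin le show ?thesis by (rule that)
qed

text \<open>
  The sublevel sets of a continuous sublinear functional are intersections of closed half-spaces.
  This replaces Mazur's theorem for \<open>F\<close> and, with \<open>p = norm\<close>, shows that the continuous
  functionals determine the norm.
\<close>

lemma sublinear_eq_sup_of_functionals:
  fixes p :: "'a::real_normed_vector \<Rightarrow> real"
  assumes p: "sublinear p" and M: "\<And>x. p x \<le> M * norm x"
  shows "p v \<le> c \<longleftrightarrow> (\<forall>f::'a \<Rightarrow>\<^sub>L real. (\<forall>x. f x \<le> p x) \<longrightarrow> f v \<le> c)"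
proof
  assume R: "\<forall>f::'a \<Rightarrow>\<^sub>L real. (\<forall>x. f x \<le> p x) \<longrightarrow> f v \<le> c"
  obtain f where f: "linear f" "\<And>x. f x \<le> p x" "f v = p v"
    using Hahn_Banach_dominated[OF p] by blast
  have "\<bar>f x\<bar> \<le> M * norm x" for x
    using f(2)[of x] M[of x] f(2)[of "- x"] M[of "- x"] linear_neg[OF f(1), of x] by auto
  then have "bounded_linear f"
    using f(1) by (intro bounded_linear_intro[of f M])
      (auto simp: linear_add linear_scale mult.commute)
  then have "f v \<le> c"
    using R[rule_format, of "Blinfun f"] f(2) by (simp add: bounded_linear_Blinfun_apply)
  then show "p v \<le> c" using f(3) by simp
qed (meson order_trans)

section \<open>The Minkowski functional and the time functions\<close>

definition minkowski :: "'a::real_vector set \<Rightarrow> 'a \<Rightarrow> real" where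
  "minkowski F v = Inf {t. 0 \<le> t \<and> v \<in> (*\<^sub>R) t ` F}"

locale convex_body =
  fixes F :: "'a::real_normed_vector set"
  assumes closed: "closed F" and bounded: "bounded F" and convex: "convex F"
    and zero_interior: "0 \<in> interior F"
begin

lemma zero_in: "0 \<in> F"
  using zero_interior interior_subset by blast

lemma scaled_mono:
  assumes "0 \<le> s" "s \<le> t" "v \<in> (*\<^sub>R) s ` F"
  shows "v \<in> (*\<^sub>R) t ` F"
proof (cases "t = 0")
  case False
  obtain w where w: "w \<in> F" "v = s *\<^sub>R w" using assms by auto
  have "(s / t) *\<^sub>R w + (1 - s / t) *\<^sub>R 0 \<in> F"
    using assms False w(1) zero_in by (intro convexD[OF convex]) auto
  then have "t *\<^sub>R ((s / t) *\<^sub>R w) \<in> (*\<^sub>R) t ` F" by (intro imageI) simp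
  then show ?thesis using False w(2) by simp
qed (use assms in auto)

lemma norm_bounded_by_radius:
  obtains R where "0 < R" "\<And>v. v \<in> F \<Longrightarrow> norm v \<le> R"
  using bounded unfolding bounded_pos by auto

text \<open>
  A quantitative form of \<open>0\<close> being interior. Negative \<open>t\<close> satisfies the hypothesis for no \<open>v\<close>, and
  \<open>t = 0\<close> only for \<open>v = 0\<close>.
\<close>

lemma small_ball_in_scaled:
  obtains r where "0 < r" "\<And>t v. norm v \<le> r * t \<Longrightarrow> v \<in> (*\<^sub>R) t ` F"
proof -
  obtain r where r: "0 < r" "cball 0 r \<subseteq> F"
    using zero_interior by (meson mem_interior_cball)
  have "v \<in> (*\<^sub>R) t ` F" if v: "norm v \<le> r * t" for t v
  proof (cases "t > 0")
    case True
    then have "v /\<^sub>R t \<in> F" using v r by (intro subsetD[OF r(2)]) (simp add: field_simps)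
    then have "t *\<^sub>R (v /\<^sub>R t) \<in> (*\<^sub>R) t ` F" by blast
    then show ?thesis using True by simp
  next
    case False
    then have "r * t \<le> 0" using r(1) by (simp add: mult_nonneg_nonpos)
    with v norm_ge_zero[of v] have "norm v = 0" "r * t = 0" by linarith+
    then have "t = 0" "v = 0" using r(1) by auto
    then show ?thesis using zero_in by force
  qed
  with r(1) show ?thesis by (rule that)
qed

lemma minkowski_feasible: "{t. 0 \<le> t \<and> v \<in> (*\<^sub>R) t ` F} \<noteq> {}"
proof -
  obtain r where r: "0 < r" "\<And>t v. norm v \<le> r * t \<Longrightarrow> v \<in> (*\<^sub>R) t ` F"
    using small_ball_in_scaled by blast
  then have "v \<in> (*\<^sub>R) (norm v / r) ` F" by (intro r(2)) simp
  with r(1) show ?thesis by (auto intro!: exI[of _ "norm v / r"])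
qed

lemma minkowski_nonneg: "0 \<le> minkowski F v"
  unfolding minkowski_def using minkowski_feasible by (intro cInf_greatest) auto

text \<open>
  The infimum in the Minkowski functional is attained. For \<open>c > 0\<close> this is closedness of \<open>F\<close>; for
  \<open>c = 0\<close> it says that \<open>\<Inter>\<^sub>e e F = {0}\<close>, which is boundedness of \<open>F\<close>.
\<close>

lemma scaled_if_all_larger_scaled:
  assumes c: "0 \<le> c" and larger: "\<And>e. 0 < e \<Longrightarrow> v \<in> (*\<^sub>R) (c + e) ` F"
  shows "v \<in> (*\<^sub>R) c ` F"
proof (cases "c = 0")
  case True
  obtain R where R: "0 < R" "\<And>v. v \<in> F \<Longrightarrow> norm v \<le> R"
    using norm_bounded_by_radius by blast
  have "norm v \<le> 0 + e" if e: "0 < e" for e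
  proof -
    obtain w where w: "w \<in> F" "v = (e / R) *\<^sub>R w"
      using larger[of "e / R"] True e R(1) by auto
    then show ?thesis using R e by (simp add: field_simps)
  qed
  then have "norm v \<le> 0" by (rule field_le_epsilon)
  then show ?thesis using True zero_in by force
next
  case False
  have lim: "(\<lambda>n. v /\<^sub>R (c + inverse (real (Suc n)))) \<longlonglongrightarrow> v /\<^sub>R (c + 0)"
    using c False by (intro tendsto_intros LIMSEQ_inverse_real_of_nat) auto
  have mem: "v /\<^sub>R (c + inverse (real (Suc n))) \<in> F" for n
  proof -
    have pos: "c + inverse (real (Suc n)) > 0" using c by (simp add: add_nonneg_pos)
    then show ?thesis using larger[of "inverse (real (Suc n))"] by auto
  qed
  have "v /\<^sub>R c \<in> F"
    using closed_sequentially[OF closed mem lim] by simp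
  then have "c *\<^sub>R (v /\<^sub>R c) \<in> (*\<^sub>R) c ` F" by blast
  then show ?thesis using False by simp
qed

lemma minkowski_le_iff:
  assumes "0 \<le> c"
  shows "minkowski F v \<le> c \<longleftrightarrow> v \<in> (*\<^sub>R) c ` F"
proof
  assume le: "minkowski F v \<le> c"
  show "v \<in> (*\<^sub>R) c ` F"
  proof (rule scaled_if_all_larger_scaled[OF assms])
    fix e :: real assume "0 < e"
    then obtain t where "0 \<le> t" "v \<in> (*\<^sub>R) t ` F" "t < c + e"
      using cInf_lessD[OF minkowski_feasible, of v "c + e"] le unfolding minkowski_def by auto
    then show "v \<in> (*\<^sub>R) (c + e) ` F" using scaled_mono[of t "c + e" v] by simp
  qed
next
  assume "v \<in> (*\<^sub>R) c ` F"
  then show "minkowski F v \<le> c"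
    unfolding minkowski_def using assms by (intro cInf_lower bdd_belowI[of _ 0]) auto
qed

lemma minkowski_decompose:
  obtains w where "w \<in> F" "v = minkowski F v *\<^sub>R w"
  using minkowski_le_iff[OF minkowski_nonneg, of v v] by auto

lemma sublinear_minkowski: "sublinear (minkowski F)"
proof (rule sublinearI)
  fix x y
  obtain u v where uv: "u \<in> F" "x = minkowski F x *\<^sub>R u" "v \<in> F" "y = minkowski F y *\<^sub>R v"
    using minkowski_decompose by metis
  let ?s = "minkowski F x" and ?t = "minkowski F y"
  have "x + y \<in> (*\<^sub>R) (?s + ?t) ` F"
  proof (cases "?s + ?t = 0")
    case True
    then have "?s = 0" "?t = 0" using minkowski_nonneg[of x] minkowski_nonneg[of y] by auto
    then have "x + y = 0" using uv(2,4) by simp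
    then show ?thesis using zero_in by force
  next
    case False
    \<comment> \<open>the sum is \<open>?s + ?t\<close> times a convex combination of two points of \<open>F\<close>\<close>
    have "(?s / (?s + ?t)) *\<^sub>R u + (?t / (?s + ?t)) *\<^sub>R v \<in> F"
      using uv minkowski_nonneg False
      by (intro convexD[OF convex]) (auto simp: add_divide_distrib[symmetric])
    then have "(?s + ?t) *\<^sub>R ((?s / (?s + ?t)) *\<^sub>R u + (?t / (?s + ?t)) *\<^sub>R v) \<in> (*\<^sub>R) (?s + ?t) ` F"
      by blast
    then show ?thesis using False uv(2,4) by (simp add: scaleR_add_right)
  qed
  then show "minkowski F (x + y) \<le> ?s + ?t"
    using minkowski_nonneg by (subst minkowski_le_iff) auto
next
  have "minkowski F 0 \<le> 0" using zero_in by (subst minkowski_le_iff) force+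
  then show "minkowski F 0 = 0" using minkowski_nonneg[of 0] by simp
next
  fix t :: real and x assume t: "0 < t"
  obtain u where u: "u \<in> F" "x = minkowski F x *\<^sub>R u" using minkowski_decompose by blast
  have "t *\<^sub>R x = (t * minkowski F x) *\<^sub>R u" using u(2) by (metis scaleR_scaleR)
  then show "minkowski F (t *\<^sub>R x) \<le> t * minkowski F x"
    using u(1) t minkowski_nonneg by (subst minkowski_le_iff) auto
qed

lemma minkowski_le_norm:
  obtains M where "0 < M" "\<And>v. minkowski F v \<le> M * norm v"
proof -
  obtain r where r: "0 < r" "\<And>t v. norm v \<le> r * t \<Longrightarrow> v \<in> (*\<^sub>R) t ` F"
    using small_ball_in_scaled by blast
  have "minkowski F v \<le> inverse r * norm v" for v
    using r(1) by (subst minkowski_le_iff) (auto intro!: r(2) simp: field_simps)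
  with r(1) show ?thesis by (intro that[of "inverse r"]) auto
qed

lemma norm_le_minkowski:
  obtains R where "0 < R" "\<And>v. norm v \<le> R * minkowski F v"
proof -
  obtain R where R: "0 < R" "\<And>v. v \<in> F \<Longrightarrow> norm v \<le> R"
    using norm_bounded_by_radius by blast
  have "norm v \<le> R * minkowski F v" for v
  proof -
    obtain w where w: "w \<in> F" "v = minkowski F v *\<^sub>R w" using minkowski_decompose by blast
    then have "norm v = minkowski F v * norm w" using minkowski_nonneg by (metis abs_of_nonneg norm_scaleR)
    also have "\<dots> \<le> minkowski F v * R" using R(2)[OF w(1)] minkowski_nonneg by (rule mult_left_mono)
    finally show ?thesis by (simp add: mult.commute)
  qed
  with R(1) show ?thesis by (rule that)
qed

lemma mem_dilate_iff:
  assumes "0 \<le> t"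
  shows "q \<in> dilate F x t \<longleftrightarrow> minkowski F (q - x) \<le> t"
  unfolding minkowski_le_iff[OF assms] dilate_def 
  by (auto simp: image_iff diff_eq_eq add.commute)

lemma max_time_le_iff:
  assumes "Q \<noteq> {}" "bounded Q"
  shows "max_time F x Q \<le> c \<longleftrightarrow> (\<forall>q\<in>Q. minkowski F (q - x) \<le> c)"
proof -
  let ?T = "{t. 0 \<le> t \<and> (\<forall>q\<in>Q. minkowski F (q - x) \<le> t)}"
  have T: "{t. 0 \<le> t \<and> Q \<subseteq> dilate F x t} = ?T"
    using mem_dilate_iff by auto
  have ne: "?T \<noteq> {}" using max_time_feasible[OF zero_interior assms(2), of x] T by simp
  have "minkowski F (q - x) \<le> Inf ?T" if "q \<in> Q" for q
    using that ne by (intro cInf_greatest) auto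
  moreover have "Inf ?T \<le> c" if c: "\<forall>q\<in>Q. minkowski F (q - x) \<le> c"
  proof -
    obtain q where "q \<in> Q" using assms(1) by auto
    with c minkowski_nonneg[of "q - x"] have "0 \<le> c" by (meson order_trans)
    then show ?thesis using c by (intro cInf_lower bdd_belowI[of _ 0]) auto
  qed
  ultimately show ?thesis
    unfolding max_time_def T by (meson order_trans)
qed

text \<open>
  The slack \<open>e\<close> cannot be dropped in general: the infimum over \<open>Q\<close> need not be attained in an
  infinite-dimensional space.
\<close>

lemma min_time_le_iff:
  assumes "Q \<noteq> {}"
  shows "min_time F x Q \<le> c \<longleftrightarrow> (\<forall>e>0. \<exists>q\<in>Q. minkowski F (q - x) \<le> c + e)"
proof -
  let ?T = "{t. 0 \<le> t \<and> (\<exists>q\<in>Q. minkowski F (q - x) \<le> t)}"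
  have T: "{t. 0 \<le> t \<and> dilate F x t \<inter> Q \<noteq> {}} = ?T"
    using mem_dilate_iff by auto
  have ne: "?T \<noteq> {}" using min_time_feasible[OF zero_interior assms, of x] T by simp
  show ?thesis
    unfolding min_time_def T
  proof (intro iffI allI impI)
    fix e :: real assume "Inf ?T \<le> c" "0 < e"
    then have "Inf ?T < c + e" by simp
    then show "\<exists>q\<in>Q. minkowski F (q - x) \<le> c + e"
      using cInf_lessD[OF ne] by force
  next
    assume R: "\<forall>e>0. \<exists>q\<in>Q. minkowski F (q - x) \<le> c + e"
    have "Inf ?T \<le> c + e" if e: "0 < e" for e
    proof -
      obtain q where q: "q \<in> Q" "minkowski F (q - x) \<le> c + e" using R e by blast
      with minkowski_nonneg[of "q - x"] have "0 \<le> c + e" by (meson order_trans)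
      then show ?thesis using q by (intro cInf_lower bdd_belowI[of _ 0]) auto
    qed
    then show "Inf ?T \<le> c" by (rule field_le_epsilon)
  qed
qed

lemma bounded_max_time_sublevel:
  assumes "Q \<noteq> {}" "bounded Q"
  shows "bounded {x. max_time F x Q \<le> c}"
proof -
  obtain R where R: "0 < R" "\<And>v. norm v \<le> R * minkowski F v" using norm_le_minkowski by blast
  obtain q where q: "q \<in> Q" using assms by auto
  have "dist q x \<le> R * c" if "max_time F x Q \<le> c" for x
  proof -
    have "minkowski F (q - x) \<le> c" using that q max_time_le_iff[OF assms] by blast
    then show ?thesis
      using R(2)[of "q - x"] mult_left_mono[of "minkowski F (q - x)" c R] R(1)
      unfolding dist_norm by linarith
  qed
  then show ?thesis unfolding bounded_def by auto
qed

lemma bounded_min_time_sublevel: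
  assumes "Q \<noteq> {}" "bounded Q"
  shows "bounded {x. min_time F x Q \<le> c}"
proof -
  obtain R where R: "0 < R" "\<And>v. norm v \<le> R * minkowski F v" using norm_le_minkowski by blast
  obtain B where B: "\<And>q. q \<in> Q \<Longrightarrow> norm q \<le> B" using assms(2) by (auto simp: bounded_iff)
  have "norm x \<le> B + R * (c + 1)" if x: "min_time F x Q \<le> c" for x
  proof -
    obtain q where q: "q \<in> Q" "minkowski F (q - x) \<le> c + 1"
      using x[unfolded min_time_le_iff[OF assms(1)], rule_format, OF zero_less_one] by blast
    have "norm (q - x) \<le> R * (c + 1)"
      using R(2)[of "q - x"] mult_left_mono[OF q(2), of R] R(1) by linarith
    then show ?thesis using B[OF q(1)] norm_triangle_sub[of x q] by (simp add: norm_minus_commute)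
  qed
  then show ?thesis unfolding bounded_iff by blast
qed

lemma max_time_nonneg:
  assumes "Q \<noteq> {}" "bounded Q"
  shows "0 \<le> max_time F x Q"
  using max_time_le_iff[OF assms, of x "max_time F x Q"] assms(1) minkowski_nonneg
  by (metis equals0I order_refl order_trans)

lemma min_time_nonneg: 
  assumes "Q \<noteq> {}"
  shows "0 \<le> min_time F x Q"
  unfolding min_time_def using min_time_feasible[OF zero_interior assms] by (intro cInf_greatest) auto

end

section \<open>Lower semicontinuity and attainment of minima\<close>

text \<open>
  Defined by closed sublevel sets, since this is the form in which compactness uses it and the
  weak topology need not be metrizable.
\<close>

definition lsc_map :: "'a topology \<Rightarrow> ('a \<Rightarrow> real) \<Rightarrow> bool" where
  "lsc_map T f \<longleftrightarrow> (\<forall>c. closedin T {x \<in> topspace T. f x \<le> c})"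

text \<open>
  \<open>c < f x + g x\<close> holds iff some \<open>q\<close> satisfies \<open>q < f x\<close> and \<open>c - q < g x\<close>, so the strict superlevel set of the
  sum is a union of open sets.
\<close>

lemma lsc_map_add:
  assumes "lsc_map T f" "lsc_map T g"
  shows "lsc_map T (\<lambda>x. f x + g x)"
proof -
  have opens: "openin T {x \<in> topspace T. q < h x}" if "lsc_map T h" for h q
  proof -
    have "{x \<in> topspace T. q < h x} = topspace T - {x \<in> topspace T. h x \<le> q}" by auto
    then show ?thesis using that by (simp add: lsc_map_def openin_diff)
  qed
  have "closedin T {x \<in> topspace T. f x + g x \<le> c}" for c
  proof -
    have "\<exists>q. q < f x \<and> c - q < g x" if "c < f x + g x" for x
      using that dense[of "c - g x" "f x"] by (auto simp: algebra_simps)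
    then have "topspace T - {x \<in> topspace T. f x + g x \<le> c} =
        (\<Union>q. {x \<in> topspace T. q < f x} \<inter> {x \<in> topspace T. c - q < g x})"
      by force
    moreover have "openin T \<dots>"
      using opens assms by (intro openin_Union) (auto intro!: openin_Int)
    ultimately show ?thesis by (simp add: closedin_def)
  qed
  then show ?thesis by (simp add: lsc_map_def)
qed

lemma lsc_map_const: "lsc_map T (\<lambda>x. a)"
proof -
  have "closedin T {x \<in> topspace T. a \<le> c}" for c by (cases "a \<le> c") auto
  then show ?thesis by (simp add: lsc_map_def)
qed

lemma lsc_map_sum:
  assumes "finite A" "\<And>i. i \<in> A \<Longrightarrow> lsc_map T (f i)"
  shows "lsc_map T (\<lambda>x. \<Sum>i\<in>A. f i x)"
  using assms
proof (induction A rule: finite_induct)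
  case (insert i A)
  then have "lsc_map T (\<lambda>x. f i x + (\<Sum>j\<in>A. f j x))" by (intro lsc_map_add) auto
  with insert show ?case by simp
qed (simp add: lsc_map_const)

lemma closedin_Collect_ball:
  assumes "\<And>i. i \<in> A \<Longrightarrow> closedin T {x \<in> topspace T. P i x}"
  shows "closedin T {x \<in> topspace T. \<forall>i\<in>A. P i x}"
proof (cases "A = {}")
  case False
  have "{x \<in> topspace T. \<forall>i\<in>A. P i x} = (\<Inter>i\<in>A. {x \<in> topspace T. P i x})"
    using False by auto
  with False assms show ?thesis by auto
qed simp

text \<open>
  The sublevel sets at the values of \<open>f\<close> up to \<open>f x0\<close> are closed, and finitely many of them meet
  in \<open>K\<close> at a point with the least of these values. A point common to all of them is a minimizer.
\<close>

lemma lsc_map_attains_min: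
  assumes f: "lsc_map T f" and S: "closedin T S" and K: "compactin T K" and x0: "x0 \<in> S"
    and sub: "\<And>x. x \<in> S \<Longrightarrow> f x \<le> f x0 \<Longrightarrow> x \<in> K"
  shows "optimal_solutions f S \<noteq> {}"
proof -
  define S0 where "S0 = {x \<in> S. f x \<le> f x0}"
  define L where "L y = {x \<in> S. f x \<le> f y}" for y
  have L: "L y = S \<inter> {x \<in> topspace T. f x \<le> f y}" for y
    using closedin_subset[OF S] by (auto simp: L_def)
  have closed: "\<forall>C\<in>L ` S0. closedin T C"
    using f S by (auto simp: L lsc_map_def)
  have fip: "K \<inter> \<Inter> \<F> \<noteq> {}" if "finite \<F> \<and> \<F> \<subseteq> L ` S0" for \<F>
  proof -
    from that obtain Y where Y: "finite Y" "Y \<subseteq> S0" "\<F> = L ` Y"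
      by (meson finite_subset_image)
    \<comment> \<open>inserting \<open>x0\<close> keeps the finite set nonempty\<close>
    have Y': "finite (insert x0 Y)" "insert x0 Y \<subseteq> S0" using Y x0 by (auto simp: S0_def)
    obtain m where m: "m \<in> insert x0 Y" "\<And>y. y \<in> insert x0 Y \<Longrightarrow> f m \<le> f y"
      using ex_is_arg_min_if_finite[OF Y'(1), of f] by (auto simp: is_arg_min_linorder)
    then have "m \<in> K \<inter> \<Inter> \<F>" using Y' Y sub by (auto simp: S0_def L_def)
    then show ?thesis by blast
  qed
  have "K \<inter> \<Inter> (L ` S0) \<noteq> {}"
    using K closed fip unfolding compactin_fip by blast
  then obtain x where x: "\<And>y. y \<in> S0 \<Longrightarrow> x \<in> L y" by blast
  have "x0 \<in> S0" using x0 by (simp add: S0_def)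
  with x have "x \<in> S" "f x \<le> f x0" by (auto simp: L_def)
  moreover have "f x \<le> f y" if "y \<in> S" for y
    using x[of y] that \<open>f x \<le> f x0\<close> by (cases "f y \<le> f x0") (auto simp: S0_def L_def)
  ultimately show ?thesis by (auto simp: optimal_solutions_def)
qed

section \<open>The weak topology\<close>

lemma continuous_map_weak_functional:
  "continuous_map weak_topology euclideanreal (blinfun_apply (f :: 'a::real_normed_vector \<Rightarrow>\<^sub>L real))"
  unfolding continuous_map_alt topspace_weak_topology
proof (intro conjI allI impI)
  fix U :: "real set" assume "openin euclidean U"
  then have "openin weak_topology (blinfun_apply f -` U)"
    unfolding weak_topology_def by (intro topology_generated_by_Basis) auto
  then show "openin weak_topology (blinfun_apply f -` U \<inter> UNIV)" by simp
qed simp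

lemma continuous_map_into_weak_topology:
  assumes "\<And>f :: 'a::real_normed_vector \<Rightarrow>\<^sub>L real. continuous_map X euclideanreal (\<lambda>x. f (g x))"
  shows "continuous_map X weak_topology g"
  unfolding weak_topology_def
proof (rule continuous_on_generated_topo)
  fix V assume "V \<in> {blinfun_apply f -` U |(f :: 'a \<Rightarrow>\<^sub>L real) U. open U}"
  then obtain f :: "'a \<Rightarrow>\<^sub>L real" and U where V: "V = blinfun_apply f -` U" "open U" by auto
  have "g -` V \<inter> topspace X = (\<lambda>x. f (g x)) -` U \<inter> topspace X" using V by auto
  then show "openin X (g -` V \<inter> topspace X)"
    using assms[of f] V(2) by (simp add: continuous_map_alt)
qed (use topspace_weak_topology in \<open>auto simp: weak_topology_def topology_generated_by_topspace\<close>)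

lemma closed_if_weakly_closed:
  fixes C :: "'a::real_normed_vector set"
  assumes "closedin weak_topology C"
  shows "closed C"
proof -
  have "continuous_map euclidean weak_topology (id :: 'a \<Rightarrow> 'a)"
    by (intro continuous_map_into_weak_topology)
      (simp add: continuous_map_iff_continuous2 blinfun.continuous_on continuous_on_id)
  then show ?thesis
    using closedin_continuous_map_preimage[OF _ assms, of euclidean id] by simp
qed

lemma continuous_map_weak_add:
  "continuous_map (prod_topology weak_topology weak_topology) weak_topology
     (\<lambda>(x, y). x + y :: 'a::real_normed_vector)"
proof (rule continuous_map_into_weak_topology)
  fix f :: "'a \<Rightarrow>\<^sub>L real"
  have "continuous_map (prod_topology weak_topology weak_topology) euclideanreal (\<lambda>z. f (fst z) + f (snd z))"
    by (intro continuous_map_add)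
      (auto intro!: continuous_map_compose[OF _ continuous_map_weak_functional, unfolded o_def]
        continuous_map_fst continuous_map_snd)
  then show "continuous_map (prod_topology weak_topology weak_topology) euclideanreal (\<lambda>z. f (case z of (x, y) \<Rightarrow> x + y))"
    by (simp add: case_prod_beta blinfun.add_right)
qed

text \<open>
  This set is \<open>Q - K\<close>. It is the projection to the first factor of the closed set
  \<open>{(x, k). x + k \<in> Q}\<close>, and projecting along a compact factor is a closed map.
\<close>

lemma closedin_translates_meeting:
  fixes K Q :: "'a::real_normed_vector set"
  assumes K: "compactin weak_topology K" and Q: "closedin weak_topology Q"
  shows "closedin weak_topology {x. \<exists>k\<in>K. x + k \<in> Q}"
proof -
  let ?X = "weak_topology :: 'a topology" and ?Y = "subtopology weak_topology K"
  let ?A = "{z \<in> topspace (prod_topology ?X ?Y). (\<lambda>(x, y). x + y) z \<in> Q}"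
  have "compact_space ?Y" using K by (rule compact_space_subtopology)
  then have "closed_map (prod_topology ?X ?Y) ?X fst" by (rule closed_map_fst)
  moreover have "continuous_map (prod_topology ?X ?Y) ?X (\<lambda>(x, y). x + y)"
    using continuous_map_weak_add
    by (metis continuous_map_from_subtopology prod_topology_subtopology(2))
  then have "closedin (prod_topology ?X ?Y) ?A"
    using Q by (rule closedin_continuous_map_preimage)
  ultimately have "closedin ?X (fst ` ?A)" by (simp add: closed_map_def)
  moreover have "fst ` ?A = {x. \<exists>k\<in>K. x + k \<in> Q}"
    by (force simp: image_iff)
  ultimately show ?thesis by simp
qed

lemma closedin_sublinear_sublevel:
  fixes p :: "'a::real_normed_vector \<Rightarrow> real"
  assumes "sublinear p" "\<And>x. p x \<le> M * norm x"
  shows "closedin weak_topology {v. p v \<le> c}"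
proof -
  have "closedin weak_topology {v. f v \<le> c}" for f :: "'a \<Rightarrow>\<^sub>L real"
    using closedin_continuous_map_preimage[OF continuous_map_weak_functional, of "{..c}" f] by simp
  then have "closedin weak_topology {v \<in> topspace weak_topology. \<forall>f\<in>{f :: 'a \<Rightarrow>\<^sub>L real. \<forall>x. f x \<le> p x}. f v \<le> c}"
    by (intro closedin_Collect_ball) simp
  then show ?thesis by (simp add: sublinear_eq_sup_of_functionals[OF assms] Ball_def)
qed

text \<open>
  The ball is a weakly closed part of a continuous image of a compact set of functionals on the
  dual (Banach-Alaoglu, applied in the bidual). The linear \<open>\<phi>\<close> with
  \<open>\<bar>\<phi> f\<bar> \<le> R * norm f\<close> form a closed subset \<open>P\<close> of a product of compact intervals (Tychonoff), and
  reflexivity represents each of them by a point \<open>g \<phi>\<close>. The map \<open>g\<close> is continuous into the weak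
  topology because \<open>f (g \<phi>) = \<phi> f\<close> is a coordinate projection, and its image contains the ball because
  functionals separate points.
\<close>

lemma weakly_compact_cball:
  assumes refl: "reflexive_banach TYPE('a::real_normed_vector)"
  shows "compactin weak_topology (cball (0::'a) R)"
proof -
  let ?X = "product_topology (\<lambda>f::'a \<Rightarrow>\<^sub>L real. euclideanreal) UNIV"
  let ?B = "\<Pi>\<^sub>E f\<in>(UNIV :: ('a \<Rightarrow>\<^sub>L real) set). {- (R * norm f)..R * norm f}"
  define P where "P = {\<phi> \<in> ?B. (\<forall>f g. \<phi> (f + g) = \<phi> f + \<phi> g) \<and> (\<forall>c f. \<phi> (c *\<^sub>R f) = c * \<phi> f)}"
  have proj: "continuous_map ?X euclideanreal (\<lambda>\<phi>. \<phi> f)" for f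
    by (rule continuous_map_product_projection) simp
  have zero: "closedin ?X {\<phi> \<in> topspace ?X. h \<phi> = (0::real)}" if "continuous_map ?X euclideanreal h" for h
    using closedin_continuous_map_preimage[OF that, of "{0}"] by simp
  have add: "closedin ?X {\<phi> \<in> topspace ?X. \<phi> (f + g) - (\<phi> f + \<phi> g) = 0}" for f g
    by (intro zero continuous_map_diff continuous_map_add proj)
  have scale: "closedin ?X {\<phi> \<in> topspace ?X. \<phi> (c *\<^sub>R f) - c * \<phi> f = 0}" for c f
    by (intro zero continuous_map_diff continuous_map_real_mult_left proj)
  have "closedin ?X ({\<phi> \<in> topspace ?X. \<forall>z\<in>UNIV. \<phi> (fst z + snd z) - (\<phi> (fst z) + \<phi> (snd z)) = 0} \<inter>
     {\<phi> \<in> topspace ?X. \<forall>z\<in>UNIV. \<phi> (fst z *\<^sub>R snd z) - fst z * \<phi> (snd z) = 0})"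
    by (intro closedin_Int closedin_Collect_ball add scale)
  moreover have "compactin ?X ?B"
    by (simp add: compactin_PiE)
  ultimately have "compactin ?X (({\<phi> \<in> topspace ?X. \<forall>z\<in>UNIV. \<phi> (fst z + snd z) - (\<phi> (fst z) + \<phi> (snd z)) = 0} \<inter>
     {\<phi> \<in> topspace ?X. \<forall>z\<in>UNIV. \<phi> (fst z *\<^sub>R snd z) - fst z * \<phi> (snd z) = 0}) \<inter> ?B)"
    by (rule closed_Int_compactin)
  also have "\<dots> = P"
    by (auto simp: P_def)
  finally have P: "compactin ?X P" .
  have rep: "\<exists>x. \<forall>f. \<phi> f = blinfun_apply f x" if "\<phi> \<in> P" for \<phi>
  proof -
    have "bounded_linear \<phi>"
      using that by (intro bounded_linear_intro[of \<phi> R])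
        (auto simp: P_def PiE_iff abs_le_iff mult.commute minus_le_iff)
    then show ?thesis
      using refl unfolding reflexive_banach_def by (metis bounded_linear_Blinfun_apply)
  qed
  then obtain g where g: "\<And>\<phi> f. \<phi> \<in> P \<Longrightarrow> \<phi> f = blinfun_apply f (g \<phi>)" by metis
  have "continuous_map (subtopology ?X P) weak_topology g"
  proof (rule continuous_map_into_weak_topology)
    fix f :: "'a \<Rightarrow>\<^sub>L real"
    show "continuous_map (subtopology ?X P) euclideanreal (\<lambda>\<phi>. f (g \<phi>))"
      using continuous_map_from_subtopology[OF proj[of f], of P]
      by (rule continuous_map_eq) (use g in auto)
  qed
  then have "compactin weak_topology (g ` P)"
    using P image_compactin by (metis compactin_subtopology order_refl)
  moreover have "cball 0 R \<subseteq> g ` P"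
  proof
    fix x :: 'a assume x: "x \<in> cball 0 R"
    define \<phi> where "\<phi> f = blinfun_apply f x" for f :: "'a \<Rightarrow>\<^sub>L real"
    have "\<bar>\<phi> f\<bar> \<le> R * norm f" for f
    proof -
      have "\<bar>\<phi> f\<bar> \<le> norm f * norm x" using norm_blinfun[of f x] by (simp add: \<phi>_def)
      also have "\<dots> \<le> norm f * R" using x by (intro mult_left_mono) auto
      finally show ?thesis by (simp add: mult.commute)
    qed
    then have "\<phi> \<in> P"
      by (auto simp: P_def abs_le_iff \<phi>_def blinfun.add_left blinfun.scaleR_left minus_le_iff)
    then have "blinfun_apply f (x - g \<phi>) \<le> 0" for f :: "'a \<Rightarrow>\<^sub>L real"
      using g[of \<phi> f] by (simp add: \<phi>_def blinfun.diff_right)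
    then have "norm (x - g \<phi>) \<le> 0"
      by (subst sublinear_eq_sup_of_functionals[OF sublinear_norm, of 1]) auto
    then show "x \<in> g ` P" using \<open>\<phi> \<in> P\<close> by auto
  qed
  moreover have "closedin weak_topology (cball (0::'a) R)"
    using closedin_sublinear_sublevel[OF sublinear_norm, of 1 R] by (simp add: cball_def)
  ultimately show ?thesis
    using closed_compactin by blast
qed

section \<open>Compactness of balls in finite dimension\<close>

text \<open>
  Induction on the spanning set. The span of \<open>B\<close> is closed because bounded
  sequences in it stay in a compact set by the induction hypothesis, so a vector \<open>b\<close> outside it has positive
  distance \<open>d\<close> to it, and \<open>\<bar>t\<bar> * d \<le> norm (y + t *\<^sub>R b)\<close>. Both parts of a bounded vector \<open>y + t *\<^sub>R b\<close> are
  then bounded, so these vectors lie in a continuous image of a compact product.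
\<close>

lemma compact_span_Int_cball:
  fixes B :: "'a::real_normed_vector set"
  assumes "finite B"
  shows "compact (span B \<inter> cball 0 R)"
  using assms
proof (induction B arbitrary: R rule: finite_induct)
  case empty
  show ?case by (intro finite_imp_compact) (auto simp: span_empty)
next
  case (insert b B)
  show ?case
  proof (cases "b \<in> span B")
    case True
    then show ?thesis using insert.IH by (simp add: span_redundant)
  next
    case False
    have "closed (span B)"
      unfolding closed_sequential_limits
    proof (intro allI impI, elim conjE)
      fix s l assume s: "\<forall>n. s n \<in> span B" "s \<longlonglongrightarrow> l"
      then obtain r where "\<And>n. norm (s n) \<le> r"
        using convergent_imp_bounded[of s l] by (auto simp: bounded_iff)
      then have "s n \<in> span B \<inter> cball 0 r" for n using s(1) by simp
      then show "l \<in> span B"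
        using closed_sequentially[OF compact_imp_closed[OF insert.IH] _ s(2)] by blast
    qed
    moreover have "span B \<noteq> {}" using span_zero by blast
    ultimately have d: "infdist b (span B) > 0"
      using False infdist_pos_not_in_closed by blast
    define d where "d = infdist b (span B)"
    have coord: "\<bar>t\<bar> * d \<le> norm (y + t *\<^sub>R b)" if y: "y \<in> span B" for t y
    proof (cases "t = 0")
      case False
      have "d \<le> dist b (- (y /\<^sub>R t))"
        unfolding d_def using y by (intro infdist_le span_neg span_scale)
      then have "\<bar>t\<bar> * d \<le> \<bar>t\<bar> * norm (b + y /\<^sub>R t)"
        by (intro mult_left_mono) (simp_all add: dist_norm)
      also have "\<dots> = norm (t *\<^sub>R (b + y /\<^sub>R t))" by simp
      also have "t *\<^sub>R (b + y /\<^sub>R t) = y + t *\<^sub>R b" using False by (simp add: scaleR_add_right)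
      finally show ?thesis .
    qed simp
    \<comment> \<open>\<open>norm y \<le> norm x + \<bar>t\<bar> * norm b\<close> with \<open>\<bar>t\<bar> \<le> R / d\<close> gives the radius for \<open>y\<close>\<close>
    define A where "A = {- (R / d)..R / d} \<times> (span B \<inter> cball 0 (R + R / d * norm b))"
    let ?h = "\<lambda>(t, y). y + t *\<^sub>R b"
    have "compact (?h ` A)"
      unfolding A_def using insert.IH
      by (intro compact_continuous_image compact_Times compact_Icc)
         (auto intro!: continuous_intros simp: case_prod_beta)
    moreover have "span (insert b B) \<inter> cball 0 R = ?h ` A \<inter> cball 0 R"
    proof (intro equalityI subsetI IntI)
      fix x assume x: "x \<in> span (insert b B) \<inter> cball 0 R"
      then obtain t where t: "x - t *\<^sub>R b \<in> span B" by (auto simp: span_insert)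
      have "\<bar>t\<bar> * d \<le> R" using coord[OF t, of t] x by simp
      then have t_le: "\<bar>t\<bar> \<le> R / d" using d by (simp add: d_def field_simps)
      have "norm (x - t *\<^sub>R b) \<le> norm x + \<bar>t\<bar> * norm b"
        using norm_triangle_ineq4[of x "t *\<^sub>R b"] by simp
      also have "\<dots> \<le> R + R / d * norm b"
        using x t_le by (intro add_mono mult_right_mono) auto
      finally have "(t, x - t *\<^sub>R b) \<in> A"
        using t t_le by (auto simp: A_def abs_le_iff)
      then show "x \<in> ?h ` A" by (rule rev_image_eqI) simp
    next
      fix x assume "x \<in> ?h ` A \<inter> cball 0 R"
      then obtain t y where "y \<in> span B" "x = y + t *\<^sub>R b" by (auto simp: A_def)
      then show "x \<in> span (insert b B)"
        by (auto simp: span_insert intro!: exI[of _ t])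
    qed auto
    ultimately show ?thesis by (simp add: compact_Int_closed)
  qed
qed

lemma compact_cball_finite_dimensional:
  assumes "finite_dimensional TYPE('a::real_normed_vector)"
  shows "compact (cball (0::'a) R)"
proof -
  obtain B :: "'a set" where "finite B" "span B = UNIV"
    using assms unfolding finite_dimensional_def by blast
  then show ?thesis using compact_span_Int_cball[of B R] by simp
qed

section \<open>Existence of optimal solutions\<close>

context convex_body
begin

lemma weakly_closed_minkowski_sublevel: "closedin weak_topology {v. minkowski F v \<le> c}"
  using closedin_sublinear_sublevel[OF sublinear_minkowski] minkowski_le_norm by metis

lemma lsc_max_time_weak:
  assumes "Q \<noteq> {}" "bounded Q"
  shows "lsc_map weak_topology (\<lambda>x. max_time F x Q)"
proof -
  have "continuous_map weak_topology weak_topology (\<lambda>x. q - x)" for q :: 'a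
    by (intro continuous_map_into_weak_topology)
      (simp add: blinfun.diff_right continuous_map_diff continuous_map_weak_functional)
  then have "closedin weak_topology {x. minkowski F (q - x) \<le> c}" for q c
    using closedin_continuous_map_preimage[OF _ weakly_closed_minkowski_sublevel] by fastforce
  then have "closedin weak_topology {x \<in> topspace weak_topology. \<forall>q\<in>Q. minkowski F (q - x) \<le> c}" for c
    by (intro closedin_Collect_ball) simp
  then show ?thesis
    by (simp add: lsc_map_def max_time_le_iff[OF assms])
qed

lemma lsc_max_time_norm:
  assumes "Q \<noteq> {}" "bounded Q"
  shows "lsc_map euclidean (\<lambda>x. max_time F x Q)"
  using lsc_max_time_weak[OF assms] by (simp add: lsc_map_def closed_if_weakly_closed)

text \<open>
  Moving \<open>x\<close> by less than \<open>e / (2 M)\<close> changes \<open>\<rho>(q - x)\<close> by at most \<open>e / 2\<close>, uniformly in \<open>q\<close>, where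
  \<open>\<rho> \<le> M * norm\<close>.
\<close>

lemma lsc_min_time_norm:
  assumes Q: "Q \<noteq> {}"
  shows "lsc_map euclidean (\<lambda>x. min_time F x Q)"
proof -
  obtain M where M: "0 < M" "\<And>v. minkowski F v \<le> M * norm v" using minkowski_le_norm by blast
  have "min_time F x Q \<le> c" if x: "x \<in> closure {x. min_time F x Q \<le> c}" for x c
    unfolding min_time_le_iff[OF Q]
  proof (intro allI impI)
    fix e :: real assume e: "0 < e"
    then have "0 < e / 2 / M" using M(1) by simp
    then obtain y where y: "min_time F y Q \<le> c" "dist y x < e / 2 / M"
      using x unfolding closure_approachable by blast
    obtain q where q: "q \<in> Q" "minkowski F (q - y) \<le> c + e / 2"
      using y(1) e unfolding min_time_le_iff[OF Q] by (meson half_gt_zero)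
    have "minkowski F (y - x) \<le> e / 2"
      using M(2)[of "y - x"] y(2) M(1) by (simp add: dist_norm field_simps)
    then have "minkowski F (q - x) \<le> c + e"
      using q(2) sublinear_add[OF sublinear_minkowski, of "q - y" "y - x"] by simp
    with q(1) show "\<exists>q\<in>Q. minkowski F (q - x) \<le> c + e" by blast
  qed
  then have "closed {x. min_time F x Q \<le> c}" for c
    unfolding closure_subset_eq[symmetric] by blast
  then show ?thesis by (simp add: lsc_map_def)
qed

text \<open>
  For each \<open>e > 0\<close> the points from which \<open>Q\<close> can be reached within time \<open>c + e\<close> form the set \<open>Q - K\<close>
  with \<open>K = (c + e) F\<close>, which is weakly compact.
\<close>

lemma lsc_min_time_weak:
  assumes refl: "reflexive_banach TYPE('a)" and Q: "Q \<noteq> {}" "weakly_closed Q"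
  shows "lsc_map weak_topology (\<lambda>x. min_time F x Q)"
proof -
  obtain R where R: "0 < R" "\<And>v. norm v \<le> R * minkowski F v" using norm_le_minkowski by blast
  have K: "compactin weak_topology {v. minkowski F v \<le> c}" for c
  proof (rule closed_compactin[OF weakly_compact_cball[OF refl]])
    show "{v. minkowski F v \<le> c} \<subseteq> cball 0 (R * c)"
      using R mult_left_mono[of _ c R] by (fastforce intro: order_trans)
  qed (rule weakly_closed_minkowski_sublevel)
  have "closedin weak_topology {x \<in> topspace weak_topology. \<forall>e\<in>{0<..}. 
      \<exists>k\<in>{v. minkowski F v \<le> c + e}. x + k \<in> Q}" for c
    using closedin_translates_meeting[OF K] Q(2)
    by (intro closedin_Collect_ball) (simp add: weakly_closed_def)
  moreover have "(\<exists>k\<in>{v. minkowski F v \<le> r}. x + k \<in> Q) \<longleftrightarrow> (\<exists>q\<in>Q. minkowski F (q - x) \<le> r)" for x r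
    by (metis (no_types, lifting) add_diff_cancel_left' diff_add_cancel add.commute mem_Collect_eq)
  ultimately show ?thesis
    by (simp add: lsc_map_def min_time_le_iff[OF Q(1)] Ball_def)
qed

text \<open>
  What \<open>\<G>\<close> and \<open>\<H>\<close> share: each inherits lower semicontinuity from the time functions in any
  topology, and each dominates every single one of them.
\<close>

lemma optimal_solutions_exist:
  fixes f :: "'a \<Rightarrow> real"
  assumes \<Omega>: "\<And>i. i \<in> I \<Longrightarrow> \<Omega> i \<noteq> {} \<and> bounded (\<Omega> i)"
    and \<Theta>: "\<And>j. j \<in> J \<Longrightarrow> \<Theta> j \<noteq> {}"
    and S: "S \<noteq> {}" "closed S"
    and lsc: "\<And>T. (\<And>i. i \<in> I \<Longrightarrow> lsc_map T (\<lambda>x. max_time F x (\<Omega> i))) \<Longrightarrow>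
        (\<And>j. j \<in> J \<Longrightarrow> lsc_map T (\<lambda>x. min_time F x (\<Theta> j))) \<Longrightarrow> lsc_map T f"
    and max_le: "\<And>i x. i \<in> I \<Longrightarrow> max_time F x (\<Omega> i) \<le> f x"
    and min_le: "\<And>j x. j \<in> J \<Longrightarrow> min_time F x (\<Theta> j) \<le> f x"
    and cases: "compact S
       \<or> (I \<noteq> {} \<and> finite_dimensional TYPE('a))
       \<or> (J \<noteq> {} \<and> (\<exists>j\<in>J. compact (\<Theta> j)) \<and> finite_dimensional TYPE('a))
       \<or> (reflexive_banach TYPE('a)
          \<and> weakly_closed S \<and> (\<forall>j\<in>J. weakly_closed (\<Theta> j))
          \<and> (bounded S \<or> (\<exists>j\<in>J. bounded (\<Theta> j))))"
  shows "optimal_solutions f S \<noteq> {}"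
proof -
  obtain x0 where x0: "x0 \<in> S" using S(1) by auto
  let ?L = "{x \<in> S. f x \<le> f x0}"
  have norm: "lsc_map euclidean f"
    using \<Omega> \<Theta> by (intro lsc lsc_max_time_norm lsc_min_time_norm) auto
  have bounded_I: "bounded ?L" if I: "I \<noteq> {}"
  proof -
    obtain i where i: "i \<in> I" using I by auto
    have "?L \<subseteq> {x. max_time F x (\<Omega> i) \<le> f x0}"
      using max_le[OF i] by (auto intro: order_trans)
    then show ?thesis using bounded_max_time_sublevel \<Omega>[OF i] bounded_subset by blast
  qed
  have bounded_J: "bounded ?L" if j: "j \<in> J" "bounded (\<Theta> j)" for j
  proof -
    have "?L \<subseteq> {x. min_time F x (\<Theta> j) \<le> f x0}"
      using min_le[OF j(1)] by (auto intro: order_trans)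
    then show ?thesis using bounded_min_time_sublevel \<Theta>[OF j(1)] j(2) bounded_subset by blast
  qed
  consider (compact) "compact S"
    | (finite_dim) "finite_dimensional TYPE('a)" "bounded ?L"
    | (reflexive) "reflexive_banach TYPE('a)" "weakly_closed S" "\<And>j. j \<in> J \<Longrightarrow> weakly_closed (\<Theta> j)"
        "bounded ?L"
    using cases bounded_I bounded_J bounded_subset[of S ?L]
    by (metis (no_types, lifting) compact_imp_bounded mem_Collect_eq subsetI)
  then show ?thesis
  proof cases
    case compact
    then show ?thesis
      using S(2) by (intro lsc_map_attains_min[OF norm _ _ x0, of S]) auto
  next
    case finite_dim
    then obtain R where "?L \<subseteq> cball 0 R" by (auto simp: bounded_iff subset_iff)
    then show ?thesis
      using compact_cball_finite_dimensional[OF finite_dim(1)] S(2)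
      by (intro lsc_map_attains_min[OF norm _ _ x0, of "cball 0 R"]) auto
  next
    case reflexive
    have weak: "lsc_map weak_topology f"
      using \<Omega> \<Theta> reflexive by (intro lsc lsc_max_time_weak lsc_min_time_weak) auto
    obtain R where "?L \<subseteq> cball 0 R"
      using reflexive(4) by (auto simp: bounded_iff subset_iff)
    then show ?thesis
      using weakly_compact_cball[OF reflexive(1)] reflexive(2)
      by (intro lsc_map_attains_min[OF weak _ _ x0, of "cball 0 R"]) (auto simp: weakly_closed_def)
  qed
qed

end

theorem theorem2p5:
  fixes F S :: "'a::real_normed_vector set"
    and I :: "'i set" and \<Omega> :: "'i \<Rightarrow> 'a set"
    and J :: "'j set" and \<Theta> :: "'j \<Rightarrow> 'a set"
  assumes "closed F" "bounded F" "convex F" "0 \<in> interior F"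
    and "finite I" "finite J" "I \<noteq> {} \<or> J \<noteq> {}"
    and "\<And>i. i \<in> I \<Longrightarrow> \<Omega> i \<noteq> {} \<and> closed (\<Omega> i) \<and> bounded (\<Omega> i)"
    and "\<And>j. j \<in> J \<Longrightarrow> \<Theta> j \<noteq> {} \<and> closed (\<Theta> j)"
    and "S \<noteq> {}" "closed S"
    and "compact S
       \<or> (I \<noteq> {} \<and> finite_dimensional TYPE('a))
       \<or> (J \<noteq> {} \<and> (\<exists>j\<in>J. compact (\<Theta> j)) \<and> finite_dimensional TYPE('a))
       \<or> (reflexive_banach TYPE('a)
          \<and> weakly_closed S \<and> (\<forall>j\<in>J. weakly_closed (\<Theta> j))
          \<and> (bounded S \<or> (\<exists>j\<in>J. bounded (\<Theta> j))))"
  shows "optimal_solutions (G_obj F I \<Omega> J \<Theta>) S \<noteq> {}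
       \<and> optimal_solutions (H_obj F I \<Omega> J \<Theta>) S \<noteq> {}"
proof -
  interpret convex_body F using assms(1-4) by unfold_locales
  let ?T = "\<lambda>x. (\<lambda>i. max_time F x (\<Omega> i)) ` I \<union> (\<lambda>j. min_time F x (\<Theta> j)) ` J"
  have T: "finite (?T x)" "?T x \<noteq> {}" for x
    using assms(5-7) by auto
  have max_nonneg: "0 \<le> max_time F x (\<Omega> i)" if "i \<in> I" for i x
    using max_time_nonneg assms(8)[OF that] by blast
  have min_nonneg: "0 \<le> min_time F x (\<Theta> j)" if "j \<in> J" for j x
    using min_time_nonneg assms(9)[OF that] by blast
  show ?thesis
  proof (intro conjI optimal_solutions_exist[where I = I and \<Omega> = \<Omega> and J = J and \<Theta> = \<Theta>])
    fix T :: "'a topology"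
    assume I: "\<And>i. i \<in> I \<Longrightarrow> lsc_map T (\<lambda>x. max_time F x (\<Omega> i))"
      and J: "\<And>j. j \<in> J \<Longrightarrow> lsc_map T (\<lambda>x. min_time F x (\<Theta> j))"
    have "closedin T ({x \<in> topspace T. \<forall>i\<in>I. max_time F x (\<Omega> i) \<le> c} \<inter>
        {x \<in> topspace T. \<forall>j\<in>J. min_time F x (\<Theta> j) \<le> c})" for c
      using I J by (intro closedin_Int closedin_Collect_ball) (auto simp: lsc_map_def)
    moreover have "{x \<in> topspace T. G_obj F I \<Omega> J \<Theta> x \<le> c} =
        {x \<in> topspace T. \<forall>i\<in>I. max_time F x (\<Omega> i) \<le> c} \<inter>
        {x \<in> topspace T. \<forall>j\<in>J. min_time F x (\<Theta> j) \<le> c}" for c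
      unfolding G_obj_def by (auto simp only: Max_le_iff[OF T] ball_Un ball_simps Int_iff mem_Collect_eq)
    ultimately show "lsc_map T (G_obj F I \<Omega> J \<Theta>)" by (simp add: lsc_map_def)
    show "lsc_map T (H_obj F I \<Omega> J \<Theta>)"
      unfolding H_obj_def using assms(5,6) I J by (intro lsc_map_add lsc_map_sum)
  next
    fix i x assume i: "i \<in> I"
    then show "max_time F x (\<Omega> i) \<le> G_obj F I \<Omega> J \<Theta> x"
      unfolding G_obj_def using T by (intro Max_ge) auto
    have "max_time F x (\<Omega> i) \<le> (\<Sum>i\<in>I. max_time F x (\<Omega> i))"
      using i assms(5) max_nonneg by (intro member_le_sum) auto
    moreover have "0 \<le> (\<Sum>j\<in>J. min_time F x (\<Theta> j))"
      using min_nonneg by (rule sum_nonneg)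
    ultimately show "max_time F x (\<Omega> i) \<le> H_obj F I \<Omega> J \<Theta> x"
      unfolding H_obj_def by linarith
  next
    fix j x assume j: "j \<in> J"
    then show "min_time F x (\<Theta> j) \<le> G_obj F I \<Omega> J \<Theta> x"
      unfolding G_obj_def using T by (intro Max_ge) auto
    have "min_time F x (\<Theta> j) \<le> (\<Sum>j\<in>J. min_time F x (\<Theta> j))"
      using j assms(6) min_nonneg by (intro member_le_sum) auto
    moreover have "0 \<le> (\<Sum>i\<in>I. max_time F x (\<Omega> i))"
      using max_nonneg by (rule sum_nonneg)
    ultimately show "min_time F x (\<Theta> j) \<le> H_obj F I \<Omega> J \<Theta> x"
      unfolding H_obj_def by linarith
  qed (use assms in auto)
qed

end
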